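(* Let $Y$ be a random variable whose moment generating function $E[e^{tY}]$ exists for $|t|<r$, for some $r>0$, and define $B_{n}^{(c,Y)}(x)$ by $$e^{x(E[e^{\frac{Y}{2}t}]-E[e^{-\frac{Y}{2}t}])}= \sum_{n=0}^{\infty}B_{n}^{(c,Y)}(x)\frac{t^{n}}{n!}.$$ Then for every $n\ge0$, $$B_{n+1}^{(c,Y)}(x)= x\sum_{l=0}^{\lfloor n/2\rfloor}\binom{n}{2l}\Big(\frac{1}{2}\Big)^{2l}E\big[Y^{2l+1}\big]B_{n-2l}^{(c,Y)}(x).$$ *)

theory Defs
  imports "HOL-Probability.Probability"
begin

text \<open>
  The values \<open>B\<^sub>n\<close> at a real point \<open>x\<close> are defined through their exponential generating function:
  they are the coefficients of the power series in \<open>t\<close> that converges to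
  \<open>exp (x (E[exp (Y t / 2)] - E[exp (- Y t / 2)]))\<close> in a neighbourhood of \<open>t = 0\<close>.
  There is at most one such coefficient sequence, and one exists whenever the moment generating
  function of \<open>Y\<close> is finite near \<open>0\<close>; the definite description is meaningful only in that case.
\<close>

definition prob_central_bell :: "'a measure \<Rightarrow> ('a \<Rightarrow> real) \<Rightarrow> nat \<Rightarrow> real \<Rightarrow> real" where
  "prob_central_bell M Y n x =
     (THE b :: nat \<Rightarrow> real.
        \<forall>\<^sub>F t in nhds 0.
          (\<lambda>k. b k * (t ^ k / fact k)) sums
            exp (x * ((\<integral>\<omega>. exp (Y \<omega> / 2 * t) \<partial>M) - (\<integral>\<omega>. exp (- (Y \<omega> / 2) * t) \<partial>M)))) n"

end

theory Submission
  imports Defs "HOL-Complex_Analysis.Laurent_Convergence"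
begin

text \<open>
  The moment generating function of \<open>Y\<close> is the exponential generating function of its moments near
  \<open>0\<close>, by dominated convergence with the bound \<open>exp (s Y) + exp (- s Y)\<close>. Hence
  \<open>G(t) = E[exp (Y t / 2)] - E[exp (- Y t / 2)]\<close> is an odd power series, and the generating function
  \<open>H = exp (x G)\<close> satisfies \<open>H' = x G' H\<close>; the recurrence is this differential equation
  read off coefficientwise.
\<close>

section \<open>Real power series expansions: uniqueness and composition\<close>

lemma fps_nth_eq_higher_deriv:
  fixes f :: "'a :: {banach, real_normed_field} \<Rightarrow> 'a"
  assumes "f has_fps_expansion F"
  shows "fps_nth F n = (deriv ^^ n) f 0 / fact n"
  using assms
proof (induction n arbitrary: f F)
  case 0
  then show ?case
    by (simp add: has_fps_expansion_imp_0_eq_fps_nth_0)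
next
  case (Suc n)
  have "of_nat (Suc n) * fps_nth F (Suc n) = (deriv ^^ n) (deriv f) 0 / fact n"
    using Suc.IH[OF has_fps_expansion_deriv[OF Suc.prems]] by simp
  then show ?case
    by (simp add: funpow_Suc_right field_simps del: funpow.simps of_nat_Suc)
qed

text \<open>Both series must have the Taylor coefficients of \<open>f\<close> at 0.\<close>

lemma fps_expansion_unique_real:
  fixes F G :: "real fps"
  assumes "f has_fps_expansion F" "f has_fps_expansion G"
  shows "F = G"
  using assms by (simp add: fps_eq_iff fps_nth_eq_higher_deriv)

text \<open>The embedding of real into complex series; it lets composition of convergent series be
  done by complex analysis and then restricted to the real axis.\<close>

definition fps_complex_of_real :: "real fps \<Rightarrow> complex fps" where
  "fps_complex_of_real F = Abs_fps (\<lambda>n. of_real (fps_nth F n))"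

lemma fps_nth_complex_of_real [simp]:
  "fps_nth (fps_complex_of_real F) n = of_real (fps_nth F n)"
  by (simp add: fps_complex_of_real_def)

lemma fps_conv_radius_complex_of_real [simp]:
  "fps_conv_radius (fps_complex_of_real F) = fps_conv_radius F"
proof -
  have "conv_radius (\<lambda>n. norm (fps_nth (fps_complex_of_real F) n))
      = conv_radius (\<lambda>n. norm (fps_nth F n))"
    by simp
  then show ?thesis
    by (simp only: fps_conv_radius_def conv_radius_norm)
qed

lemma eval_fps_complex_of_real:
  assumes "ereal (norm t) < fps_conv_radius F"
  shows "eval_fps (fps_complex_of_real F) (of_real t) = of_real (eval_fps F t)"
proof -
  have "(\<lambda>n. fps_nth F n * t ^ n) sums eval_fps F t"
    by (rule sums_eval_fps) (use assms in simp)
  from sums_of_real[OF this, where ?'a = complex] show ?thesis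
    by (simp add: eval_fps_def sums_iff)
qed

lemma fps_complex_of_real_power:
  "fps_complex_of_real (F ^ k) = fps_complex_of_real F ^ k"
proof (induction k)
  case (Suc k)
  have "fps_complex_of_real (F * F ^ k) = fps_complex_of_real F * fps_complex_of_real (F ^ k)"
    by (simp add: fps_eq_iff fps_mult_nth)
  with Suc show ?case
    by simp
qed (simp add: fps_eq_iff)

lemma fps_complex_of_real_compose:
  "fps_complex_of_real (F oo G) = fps_complex_of_real F oo fps_complex_of_real G"
  by (simp add: fps_eq_iff fps_compose_nth flip: fps_complex_of_real_power)

text \<open>Complexify both series, compose there, and come back along the real axis: the embedding
  commutes with composition, preserves the radius of convergence, and respects evaluation inside the
  disc.\<close>

lemma has_fps_expansion_compose_real:
  fixes f g :: "real \<Rightarrow> real"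
  assumes f: "f has_fps_expansion F" and g: "g has_fps_expansion G" and G0: "fps_nth G 0 = 0"
  shows "(\<lambda>t. f (g t)) has_fps_expansion (F oo G)"
proof -
  let ?F = "fps_complex_of_real F" and ?G = "fps_complex_of_real G"
  have radF: "fps_conv_radius F > 0" and radG: "fps_conv_radius G > 0"
    using f g by (auto simp: has_fps_expansion_def)
  have small: "\<forall>\<^sub>F t in nhds (0 :: real). ereal (norm t) < fps_conv_radius A"
    if "fps_conv_radius A > 0" for A :: "real fps"
  proof -
    have "\<forall>\<^sub>F t in nhds (0 :: real). t \<in> eball 0 (fps_conv_radius A)"
      using that by (intro eventually_nhds_in_open) (auto simp: zero_ereal_def)
    then show ?thesis by simp
  qed
  have "(eval_fps ?F \<circ> eval_fps ?G) has_fps_expansion (?F oo ?G)"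
    by (rule has_fps_expansion_compose)
      (use radF radG G0 in \<open>auto intro: eval_fps_has_fps_expansion\<close>)
  then have comp: "(eval_fps ?F \<circ> eval_fps ?G) has_fps_expansion fps_complex_of_real (F oo G)"
    by (simp add: fps_complex_of_real_compose)
  then have rad: "fps_conv_radius (F oo G) > 0"
    by (simp add: has_fps_expansion_def)
  \<comment> \<open>This pulls an identity valid for complex arguments near 0 back to real
    \<open>t\<close> near 0.\<close>
  have to0: "filterlim (of_real :: real \<Rightarrow> complex) (nhds 0) (nhds 0)"
    using tendsto_of_real[OF filterlim_ident, of 0] by simp
  have g0: "g 0 = 0"
    using g G0 by (simp add: has_fps_expansion_imp_0_eq_fps_nth_0)
  \<comment> \<open>Continuity of \<open>g\<close> at its zero puts \<open>g t\<close> inside the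
    disc of convergence of \<open>F\<close> for small \<open>t\<close>.\<close>
  have gto0: "filterlim g (nhds 0) (nhds 0)"
    using has_fps_expansion_imp_continuous[OF g, of UNIV] g0 tendsto_at_iff_tendsto_nhds[of g 0]
    by (simp add: isCont_def)
  have "\<forall>\<^sub>F t in nhds 0. eval_fps (fps_complex_of_real (F oo G)) (of_real t) =
      eval_fps ?F (eval_fps ?G (of_real t))"
    using comp to0 by (auto simp: has_fps_expansion_def filterlim_iff)
  moreover have "\<forall>\<^sub>F t in nhds 0. eval_fps F (g t) = f (g t)"
    using f gto0 by (auto simp: has_fps_expansion_def filterlim_iff)
  moreover have "\<forall>\<^sub>F t in nhds 0. ereal (norm (g t)) < fps_conv_radius F"
    using small[OF radF] gto0 by (auto simp: filterlim_iff)
  moreover have "\<forall>\<^sub>F t in nhds 0. eval_fps G t = g t"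
    using g by (simp add: has_fps_expansion_def)
  ultimately have "\<forall>\<^sub>F t in nhds 0. eval_fps (F oo G) t = f (g t)"
    using small[OF radG] small[OF rad]
  proof eventually_elim
    case (elim t)
    then show ?case
      by (simp add: eval_fps_complex_of_real)
  qed
  with rad show ?thesis
    by (simp add: has_fps_expansion_def)
qed

section \<open>Moments and the moment generating function\<close>

lemma abs_exp_partial_sum_le:
  fixes u :: real
  shows "\<bar>\<Sum>k<m. u ^ k / fact k\<bar> \<le> exp u + exp (- u)"
proof -
  have "\<bar>\<Sum>k<m. u ^ k / fact k\<bar> \<le> (\<Sum>k<m. \<bar>u ^ k / fact k\<bar>)"
    by (rule sum_abs)
  also have "\<dots> = (\<Sum>k<m. \<bar>u\<bar> ^ k / fact k)"
    by (simp add: power_abs)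
  also have "\<dots> \<le> exp \<bar>u\<bar>"
    using sum_le_suminf[OF summable_exp_generic[of "\<bar>u\<bar>"], of "{..<m}"]
    by (simp add: exp_def divide_inverse mult.commute)
  also have "\<dots> \<le> exp u + exp (- u)"
    by (cases "u \<ge> 0") auto
  finally show ?thesis .
qed

lemma integrable_moment_of_mgf:
  fixes Y :: "'a \<Rightarrow> real"
  assumes [measurable]: "Y \<in> borel_measurable M"
    and "s \<noteq> 0"
    and "integrable M (\<lambda>\<omega>. exp (s * Y \<omega>))" "integrable M (\<lambda>\<omega>. exp (- (s * Y \<omega>)))"
  shows "integrable M (\<lambda>\<omega>. Y \<omega> ^ k)"
proof -
  have "integrable M (\<lambda>\<omega>. (s * Y \<omega>) ^ k / fact k)"
  proof (rule Bochner_Integration.integrable_bound)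
    show "integrable M (\<lambda>\<omega>. 2 * (exp (s * Y \<omega>) + exp (- (s * Y \<omega>))))"
      using assms by simp
    \<comment> \<open>A single term is the difference of two consecutive partial sums, whence the
      factor 2.\<close>
    have "\<bar>u ^ k / fact k\<bar> \<le> 2 * (exp u + exp (- u))" for u :: real
      using abs_exp_partial_sum_le[of u k] abs_exp_partial_sum_le[of u "Suc k"] by simp
    then show "AE \<omega> in M. norm ((s * Y \<omega>) ^ k / fact k)
        \<le> norm (2 * (exp (s * Y \<omega>) + exp (- (s * Y \<omega>))))"
      by (simp add: add_nonneg_nonneg)
  qed measurable
  then have "integrable M (\<lambda>\<omega>. (fact k / s ^ k) * ((s * Y \<omega>) ^ k / fact k))"
    by (rule integrable_mult_right)
  then show ?thesis
    using \<open>s \<noteq> 0\<close> by (simp add: power_mult_distrib)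
qed

text \<open>The majorant of the partial sums does not depend on their length, so limit and integral
  may be exchanged; integrability of the moments then lets each finite sum be integrated term by
  term.\<close>

lemma mgf_sums_moments:
  fixes Y :: "'a \<Rightarrow> real"
  assumes meas [measurable]: "Y \<in> borel_measurable M"
    and moments: "\<And>k. integrable M (\<lambda>\<omega>. Y \<omega> ^ k)"
    and int: "integrable M (\<lambda>\<omega>. exp (s * Y \<omega>))" "integrable M (\<lambda>\<omega>. exp (- (s * Y \<omega>)))"
  shows "(\<lambda>k. (\<integral>\<omega>. Y \<omega> ^ k \<partial>M) / fact k * s ^ k) sums (\<integral>\<omega>. exp (s * Y \<omega>) \<partial>M)"
proof -
  have "(\<lambda>m. \<integral>\<omega>. (\<Sum>k<m. (s * Y \<omega>) ^ k / fact k) \<partial>M) \<longlonglongrightarrow> (\<integral>\<omega>. exp (s * Y \<omega>) \<partial>M)"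
  proof (rule integral_dominated_convergence)
    show "integrable M (\<lambda>\<omega>. exp (s * Y \<omega>) + exp (- (s * Y \<omega>)))"
      using int by simp
    show "AE \<omega> in M. (\<lambda>m. \<Sum>k<m. (s * Y \<omega>) ^ k / fact k) \<longlonglongrightarrow> exp (s * Y \<omega>)"
      using exp_converges[where ?'a = real]
      by (simp add: sums_def divide_inverse mult.commute)
    show "AE \<omega> in M. norm (\<Sum>k<m. (s * Y \<omega>) ^ k / fact k)
        \<le> exp (s * Y \<omega>) + exp (- (s * Y \<omega>))" for m
      using abs_exp_partial_sum_le by simp
  qed measurable
  moreover have "(\<integral>\<omega>. (\<Sum>k<m. (s * Y \<omega>) ^ k / fact k) \<partial>M)
      = (\<Sum>k<m. (\<integral>\<omega>. Y \<omega> ^ k \<partial>M) / fact k * s ^ k)" for m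
  proof -
    have "(\<integral>\<omega>. (\<Sum>k<m. (s * Y \<omega>) ^ k / fact k) \<partial>M)
        = (\<integral>\<omega>. (\<Sum>k<m. (s ^ k / fact k) * Y \<omega> ^ k) \<partial>M)"
      by (simp add: power_mult_distrib)
    also have "\<dots> = (\<Sum>k<m. (s ^ k / fact k) * (\<integral>\<omega>. Y \<omega> ^ k \<partial>M))"
      using moments by (subst Bochner_Integration.integral_sum) auto
    finally show ?thesis
      by (simp add: mult_ac)
  qed
  ultimately show ?thesis
    by (simp add: sums_def)
qed

lemma mgf_has_fps_expansion:
  fixes Y :: "'a \<Rightarrow> real"
  assumes meas: "Y \<in> borel_measurable M" and "r > 0"
    and int: "\<And>t. \<bar>t\<bar> < r \<Longrightarrow> integrable M (\<lambda>\<omega>. exp (t * Y \<omega>))"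
  shows "(\<lambda>t. \<integral>\<omega>. exp (t * Y \<omega>) \<partial>M) has_fps_expansion
           Abs_fps (\<lambda>k. (\<integral>\<omega>. Y \<omega> ^ k \<partial>M) / fact k)"
proof (rule has_fps_expansionI)
  have int': "integrable M (\<lambda>\<omega>. exp (- (t * Y \<omega>)))" if "\<bar>t\<bar> < r" for t
    using int[of "- t"] that by simp
  \<comment> \<open>The point \<open>r / 2\<close> serves as a nonzero \<open>s\<close> with both
    \<open>s\<close> and \<open>- s\<close> in the interval of finiteness.\<close>
  have moments: "integrable M (\<lambda>\<omega>. Y \<omega> ^ k)" for k
    by (rule integrable_moment_of_mgf[OF meas, of "r / 2"]) (use \<open>r > 0\<close> int[of "r / 2"] int'[of "r / 2"] in auto)
  have "\<forall>\<^sub>F t in nhds (0 :: real). t \<in> ball 0 r"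
    using \<open>r > 0\<close> by (intro eventually_nhds_in_open) auto
  then show "\<forall>\<^sub>F t in nhds 0. (\<lambda>k. fps_nth (Abs_fps (\<lambda>k. (\<integral>\<omega>. Y \<omega> ^ k \<partial>M) / fact k)) k * t ^ k)
      sums (\<integral>\<omega>. exp (t * Y \<omega>) \<partial>M)"
  proof eventually_elim
    case (elim t)
    then show ?case
      using mgf_sums_moments[OF meas moments int int', of t] by simp
  qed
qed

section \<open>Evaluating the definite description\<close>

lemma the_egf_coefficients:
  fixes h :: "real \<Rightarrow> real"
  assumes h: "h has_fps_expansion H"
  shows "(THE b. \<forall>\<^sub>F t in nhds 0. (\<lambda>k. b k * (t ^ k / fact k)) sums h t) = (\<lambda>k. fact k * fps_nth H k)"
proof (rule the_equality)
  \<comment> \<open>Existence: the factor \<open>fact k\<close> cancels the denominator of the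
    exponential series, leaving the convergent series of \<open>H\<close>.\<close>
  have "\<forall>\<^sub>F t in nhds (0 :: real). t \<in> eball 0 (fps_conv_radius H)"
    using h by (intro eventually_nhds_in_open) (auto simp: zero_ereal_def has_fps_expansion_def)
  moreover have "\<forall>\<^sub>F t in nhds 0. eval_fps H t = h t"
    using h by (simp add: has_fps_expansion_def)
  ultimately show "\<forall>\<^sub>F t in nhds 0. (\<lambda>k. (fact k * fps_nth H k) * (t ^ k / fact k)) sums h t"
  proof eventually_elim
    case (elim t)
    then show ?case
      using sums_eval_fps[of t H] by simp
  qed
next
  fix b assume b: "\<forall>\<^sub>F t in nhds 0. (\<lambda>k. b k * (t ^ k / fact k)) sums h t"
  \<comment> \<open>Uniqueness: a competing \<open>b\<close> yields a second expansion of the same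
    \<open>h\<close>.\<close>
  have "h has_fps_expansion Abs_fps (\<lambda>k. b k / fact k)"
    by (rule has_fps_expansionI) (use b in simp)
  then have "H = Abs_fps (\<lambda>k. b k / fact k)"
    using h fps_expansion_unique_real by blast
  then show "b = (\<lambda>k. fact k * fps_nth H k)"
    by simp
qed

section \<open>The recurrence from the differential equation\<close>

lemma sum_even_support:
  fixes f :: "nat \<Rightarrow> 'a :: comm_monoid_add"
  assumes "\<And>i. odd i \<Longrightarrow> f i = 0"
  shows "(\<Sum>i = 0..n. f i) = (\<Sum>l = 0..n div 2. f (2 * l))"
proof -
  have "(\<Sum>i = 0..n. f i) = sum f ((*) 2 ` {0..n div 2})"
  proof (rule sum.mono_neutral_right)
    show "\<forall>i \<in> {0..n} - (*) 2 ` {0..n div 2}. f i = 0"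
    proof
      fix i assume i: "i \<in> {0..n} - (*) 2 ` {0..n div 2}"
      have "odd i"
      proof
        assume "even i"
        then obtain l where "i = 2 * l" by (auto elim: evenE)
        with i show False by auto
      qed
      then show "f i = 0" by (rule assms)
    qed
  qed auto
  then show ?thesis
    by (simp add: sum.reindex inj_on_def)
qed

theorem theorem2p8:
  fixes M :: "'a measure" and Y :: "'a \<Rightarrow> real" and r x :: real and n :: nat
  assumes "prob_space M"
    and "Y \<in> borel_measurable M"
    and "r > 0"
    and "\<And>t::real. \<bar>t\<bar> < r \<Longrightarrow> integrable M (\<lambda>\<omega>. exp (t * Y \<omega>))"
  shows "prob_central_bell M Y (n + 1) x =
           x * (\<Sum>l = 0..n div 2.
                  real (n choose (2 * l)) * (1 / 2) ^ (2 * l) *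
                  (\<integral>\<omega>. Y \<omega> ^ (2 * l + 1) \<partial>M) * prob_central_bell M Y (n - 2 * l) x)"
proof -
  define E where "E = (\<lambda>k. \<integral>\<omega>. Y \<omega> ^ k \<partial>M)"
  \<comment> \<open>Applied below with \<open>c\<close> equal to 1/2 and -1/2; the bound on
    \<open>c\<close> keeps \<open>t * c\<close> within the radius \<open>r\<close>.\<close>
  have mgf: "(\<lambda>t. \<integral>\<omega>. exp (t * (c * Y \<omega>)) \<partial>M) has_fps_expansion Abs_fps (\<lambda>k. c ^ k * E k / fact k)"
    if "\<bar>c\<bar> \<le> 1" for c
  proof -
    have "integrable M (\<lambda>\<omega>. exp (t * (c * Y \<omega>)))" if "\<bar>t\<bar> < r" for t
    proof -
      have "\<bar>t * c\<bar> \<le> \<bar>t\<bar>"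
        using \<open>\<bar>c\<bar> \<le> 1\<close> by (simp add: abs_mult mult_left_le)
      then show ?thesis
        using assms(4)[of "t * c"] that by (simp add: mult.assoc)
    qed
    from mgf_has_fps_expansion[OF _ \<open>r > 0\<close> this] show ?thesis
      using assms(2) by (simp add: power_mult_distrib E_def)
  qed
  \<comment> \<open>The two powers cancel for even \<open>k\<close> and add up for odd
    \<open>k\<close>. In particular the constant term vanishes, as the composition in
    \<open>H\<close> requires.\<close>
  define G where "G = Abs_fps (\<lambda>k. ((1 / 2) ^ k - (- 1 / 2) ^ k) * E k / fact k)"
  define H where "H = fps_exp 1 oo (fps_const x * G)"
  have G_even: "fps_nth G k = 0" if "even k" for k
    using that by (simp add: G_def)
  have G_odd: "fps_nth G k = 2 * (1 / 2) ^ k * E k / fact k" if "odd k" for k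
    using that by (simp add: G_def)
  have "G = Abs_fps (\<lambda>k. (1 / 2) ^ k * E k / fact k) - Abs_fps (\<lambda>k. (- 1 / 2) ^ k * E k / fact k)"
    by (simp add: G_def fps_eq_iff diff_divide_distrib left_diff_distrib)
  moreover have "(\<lambda>t. (\<integral>\<omega>. exp (t * (1 / 2 * Y \<omega>)) \<partial>M) - (\<integral>\<omega>. exp (t * (- 1 / 2 * Y \<omega>)) \<partial>M))
      has_fps_expansion
        Abs_fps (\<lambda>k. (1 / 2) ^ k * E k / fact k) - Abs_fps (\<lambda>k. (- 1 / 2) ^ k * E k / fact k)"
    by (rule has_fps_expansion_diff; rule mgf) simp_all
  ultimately have "(\<lambda>t. (\<integral>\<omega>. exp (t * (1 / 2 * Y \<omega>)) \<partial>M) - (\<integral>\<omega>. exp (t * (- 1 / 2 * Y \<omega>)) \<partial>M))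
      has_fps_expansion G"
    by simp
  then have "(\<lambda>t. (\<integral>\<omega>. exp (Y \<omega> / 2 * t) \<partial>M) - (\<integral>\<omega>. exp (- (Y \<omega> / 2) * t) \<partial>M)) has_fps_expansion G"
    by (simp add: mult_ac)
  then have "(\<lambda>t. x * ((\<integral>\<omega>. exp (Y \<omega> / 2 * t) \<partial>M) - (\<integral>\<omega>. exp (- (Y \<omega> / 2) * t) \<partial>M)))
      has_fps_expansion fps_const x * G"
    by (rule has_fps_expansion_cmult_left)
  from has_fps_expansion_compose_real[OF has_fps_expansion_exp1 this]
  have "(\<lambda>t. exp (x * ((\<integral>\<omega>. exp (Y \<omega> / 2 * t) \<partial>M) - (\<integral>\<omega>. exp (- (Y \<omega> / 2) * t) \<partial>M))))
      has_fps_expansion H"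
    using G_even[of 0] by (simp add: H_def)
  from the_egf_coefficients[OF this]
  have bell: "prob_central_bell M Y k x = fact k * fps_nth H k" for k
    by (simp add: prob_central_bell_def)
  \<comment> \<open>Chain rule, the exponential series being its own derivative.\<close>
  have ode: "fps_deriv H = fps_const x * (fps_deriv G * H)"
    using G_even[of 0] by (simp add: H_def fps_compose_deriv mult_ac)
  \<comment> \<open>Of \<open>fact (n + 1)\<close>, the factor \<open>n + 1\<close> is absorbed by
    differentiation.\<close>
  have "prob_central_bell M Y (n + 1) x = fact n * fps_nth (fps_deriv H) n"
    by (simp add: bell algebra_simps)
  also have "\<dots> = x * (\<Sum>i = 0..n. fact n * (real (i + 1) * fps_nth G (i + 1)) * fps_nth H (n - i))"
    by (subst ode, simp add: fps_mult_nth[of "fps_deriv G"]) (simp add: sum_distrib_left mult_ac)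
  \<comment> \<open>Differentiation shifts the index by one, so the odd series \<open>G\<close>
    contributes only at even \<open>i\<close>.\<close>
  also have "(\<Sum>i = 0..n. fact n * (real (i + 1) * fps_nth G (i + 1)) * fps_nth H (n - i))
      = (\<Sum>l = 0..n div 2.
          fact n * (real (2 * l + 1) * fps_nth G (2 * l + 1)) * fps_nth H (n - 2 * l))"
    by (rule sum_even_support) (simp add: G_even)
  also have "\<dots> = (\<Sum>l = 0..n div 2. real (n choose (2 * l)) * (1 / 2) ^ (2 * l) *
      E (2 * l + 1) * prob_central_bell M Y (n - 2 * l) x)"
  proof (rule sum.cong[OF refl])
    fix l assume "l \<in> {0..n div 2}"
    then have l: "2 * l \<le> n" by auto
    \<comment> \<open>The factor 2 from the doubled odd coefficient removes one power of 1/2, and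
      \<open>2 * l + 1\<close> cancels against the factorial.\<close>
    have "real (2 * l + 1) * fps_nth G (2 * l + 1) = (1 / 2) ^ (2 * l) * E (2 * l + 1) / fact (2 * l)"
    proof -
      have "fact (2 * l + 1) = real (2 * l + 1) * fact (2 * l)"
        by simp
      moreover have "real (2 * l + 1) \<noteq> 0"
        by (simp del: of_nat_add of_nat_Suc)
      ultimately show ?thesis
        by (subst G_odd) (simp_all del: fact_Suc of_nat_add of_nat_mult of_nat_Suc)
    qed
    then show "fact n * (real (2 * l + 1) * fps_nth G (2 * l + 1)) * fps_nth H (n - 2 * l)
        = real (n choose (2 * l)) * (1 / 2) ^ (2 * l) * E (2 * l + 1)
            * prob_central_bell M Y (n - 2 * l) x"
      \<comment> \<open>The factorial of \<open>n - 2 * l\<close> supplied by \<open>bell\<close>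
        cancels the one in the denominator of the binomial coefficient.\<close>
      by (simp only: bell binomial_fact[OF l]) (simp add: field_simps)
  qed
  finally show ?thesis
    by (simp add: E_def)
qed

end
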